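(* Let $X$ be an infinite-dimensional Banach space over $\mathbb{K}=\mathbb{R}$ or $\mathbb{C}$ and let $C\geqslant 1$. Suppose that $X$ is $(C+\varepsilon)$-HI for some $\varepsilon>0$. Then $X$ is $C$-isomorphic to no proper subspace of itself.
   Context: By a subspace of a Banach space we mean an infinite-dimensional closed subspace. For $C\geqslant 1$, an infinite-dimensional Banach space $X$ is called $C$-HI if for all (infinite-dimensional closed) subspaces $Y,Z\subseteq X$ there exist $y\in Y$ and $z\in Z$ such that $\|y+z\|>C\|y-z\|$. Two Banach spaces $Y$ and $Z$ are $C$-isomorphic if there is a (linear, bicontinuous, surjective) isomorphism $T\colon Y\to Z$ with $\|T\|\cdot\|T^{-1}\|\leqslant C$. *)

theory Defs
  imports "HOL-Analysis.Analysis"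
begin

text \<open>
  The scalar fields \<open>\<real>\<close> and \<open>\<complex>\<close>, treated uniformly: the class axiom says that the field is
  isometrically isomorphic, as a real normed algebra, to the subfield \<open>\<real>\<close> of \<open>\<complex>\<close> or to \<open>\<complex>\<close>
  itself (injectivity of \<open>f\<close> follows from additivity and isometry).
\<close>

class real_or_complex = real_normed_field +
  assumes ex_iso_real_or_complex:
    "\<exists>f :: 'a \<Rightarrow> complex.
       (\<forall>x y. f (x + y) = f x + f y) \<and>
       (\<forall>x y. f (x * y) = f x * f y) \<and>
       (\<forall>r x. f (r *\<^sub>R x) = r *\<^sub>R f x) \<and>
       (\<forall>x. norm (f x) = norm x) \<and>
       (range f = \<real> \<or> range f = UNIV)"

instance real :: real_or_complex
  by intro_classes (rule exI[of _ complex_of_real], auto simp: Reals_def scaleR_conv_of_real)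

instance complex :: real_or_complex
  by intro_classes (rule exI[of _ id], auto)

text \<open>
  A Banach space over \<open>\<real>\<close> or \<open>\<complex>\<close>, with underlying set the whole type \<open>'a\<close>. The class \<open>banach\<close>
  supplies the complete norm and the underlying real vector space; the scalar multiplication by
  the field \<open>'k\<close> is the parameter \<open>scale\<close>. All linear notions below are over \<open>'k\<close>.
\<close>

locale banach_space_over = vector_space scale
  for scale :: "'k::real_or_complex \<Rightarrow> 'a::banach \<Rightarrow> 'a" +
  assumes scale_of_real: "scale (of_real r) x = r *\<^sub>R x"
    and norm_scale: "norm (scale c x) = norm c * norm x"
begin

definition infinite_dimensional :: "'a set \<Rightarrow> bool" where
  "infinite_dimensional V \<longleftrightarrow> (\<nexists>B. finite B \<and> span B = V)"

definition banach_subspace :: "'a set \<Rightarrow> bool" where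
  "banach_subspace Y \<longleftrightarrow> subspace Y \<and> closed Y \<and> infinite_dimensional Y"

definition HI :: "real \<Rightarrow> bool" where
  "HI C \<longleftrightarrow> infinite_dimensional UNIV \<and>
     (\<forall>Y Z. banach_subspace Y \<longrightarrow> banach_subspace Z \<longrightarrow>
        (\<exists>y\<in>Y. \<exists>z\<in>Z. norm (y + z) > C * norm (y - z)))"

definition linear_on :: "'a set \<Rightarrow> ('a \<Rightarrow> 'a) \<Rightarrow> bool" where
  "linear_on Y T \<longleftrightarrow>
     (\<forall>x\<in>Y. \<forall>y\<in>Y. T (x + y) = T x + T y) \<and> (\<forall>c. \<forall>x\<in>Y. T (scale c x) = scale c (T x))"

text \<open>
  The analogue of \<^const>\<open>onorm\<close> for an operator defined on a subspace \<open>Y\<close>; only meaningful when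
  the operator is bounded on \<open>Y\<close>, as is the case for the continuous linear maps below.
\<close>

definition onorm_on :: "'a set \<Rightarrow> ('a \<Rightarrow> 'a) \<Rightarrow> real" where
  "onorm_on Y T = (SUP x\<in>Y. norm (T x) / norm x)"

definition isomorphic_with_constant :: "real \<Rightarrow> 'a set \<Rightarrow> 'a set \<Rightarrow> bool" where
  "isomorphic_with_constant C Y Z \<longleftrightarrow>
     (\<exists>T T'. linear_on Y T \<and> homeomorphism Y Z T T' \<and> onorm_on Y T * onorm_on Z T' \<le> C)"

end

text \<open>
  Every type of class \<open>banach\<close> is a Banach space over \<open>\<real>\<close>, and \<open>\<complex>\<close>-Banach spaces are the
  instances with \<open>'k = complex\<close>.
\<close>

lemma banach_space_over_scaleR: "banach_space_over (scaleR :: real \<Rightarrow> 'a::banach \<Rightarrow> 'a)"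
  by unfold_locales (auto simp: scaleR_add_right scaleR_add_left)

end

theory Submission
  imports Defs
begin

text \<open>
  Let \<open>T\<close> be an isomorphism onto a proper subspace with \<open>a\<parallel>x\<parallel> \<le> \<parallel>T x\<parallel> \<le> b\<parallel>x\<parallel>\<close> and \<open>b \<le> C a\<close>. The index of
  \<open>T - t\<close> is negative at \<open>t = 0\<close> and zero for large \<open>t\<close>, so \<open>T - t\<close> fails to be semi-Fredholm for
  some \<open>t \<ge> 0\<close>; hence \<open>T\<close> is almost equal to \<open>t\<close> on an infinite-dimensional closed subspace. The
  same for \<open>- T\<close> gives \<open>s, t \<ge> 0\<close> with \<open>T \<approx> s\<close> on \<open>V\<close> and \<open>T \<approx> - t\<close> on \<open>W\<close>, where necessarily
  \<open>s, t\<close> are at least about \<open>a\<close>. If \<open>y \<in> V\<close> and \<open>z \<in> W\<close> satisfy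
  \<open>\<parallel>y + z\<parallel> > (C + \<epsilon>)\<parallel>y - z\<parallel>\<close>, then
  \<open>T (y - z) \<approx> s y + t z = (s + t)/2 (y + z) + (s - t)/2 (y - z)\<close> has norm at least about
  \<open>(C + \<epsilon>) a \<parallel>y - z\<parallel>\<close> because \<open>C + \<epsilon> \<ge> 1\<close>, which exceeds \<open>b\<parallel>y - z\<parallel>\<close>.
\<close>

section \<open>Norming functionals\<close>

text \<open>Only one inequality of positive homogeneity is demanded, which keeps the check for
  infima short; \<open>sublinear_scale_eq\<close> recovers the equality.\<close>

definition sublinear :: "('a::real_vector \<Rightarrow> real) \<Rightarrow> bool" where
  "sublinear p \<longleftrightarrow> (\<forall>x y. p (x + y) \<le> p x + p y) \<and> (\<forall>t\<ge>0. \<forall>x. p (t *\<^sub>R x) \<le> t * p x)"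

lemma sublinear_add: "sublinear p \<Longrightarrow> p (x + y) \<le> p x + p y"
  and sublinear_scale: "sublinear p \<Longrightarrow> 0 \<le> t \<Longrightarrow> p (t *\<^sub>R x) \<le> t * p x"
  by (auto simp: sublinear_def)

lemma sublinear_zero:
  assumes "sublinear p" shows "p 0 = 0"
  using sublinear_add[OF assms, of 0 0] sublinear_scale[OF assms, of 0 0] by simp

lemma sublinear_minus:
  assumes "sublinear p" shows "- p (- x) \<le> p x"
  using sublinear_add[OF assms, of x "- x"] sublinear_zero[OF assms] by simp

lemma sublinear_scale_eq:
  assumes "sublinear p" "0 \<le> t" shows "p (t *\<^sub>R x) = t * p x"
proof (cases "t = 0")
  case False
  then have "p x \<le> inverse t * p (t *\<^sub>R x)"
    using sublinear_scale[OF assms(1), of "inverse t" "t *\<^sub>R x"] assms(2) by simp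
  then have "t * p x \<le> p (t *\<^sub>R x)"
    using False assms(2) by (simp add: field_simps)
  then show ?thesis
    using sublinear_scale[OF assms] by (intro antisym)
qed (simp add: sublinear_zero assms)

lemma sublinear_norm: "sublinear (norm :: 'a::real_normed_vector \<Rightarrow> real)"
  by (simp add: sublinear_def norm_triangle_ineq)

text \<open>For a minimal sublinear \<open>p\<close> this shift equals \<open>p\<close>, which forces \<open>p\<close> to be additive; applied
  to the norm it prescribes the value of the functional at \<open>x\<close>.\<close>

definition sublinear_shift :: "('a::real_vector \<Rightarrow> real) \<Rightarrow> 'a \<Rightarrow> 'a \<Rightarrow> real" where
  "sublinear_shift p x y = (INF t\<in>{0..}. p (y + t *\<^sub>R x) - t * p x)"

lemma sublinear_shift_le:
  assumes p: "sublinear p" and "0 \<le> t"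
  shows "sublinear_shift p x y \<le> p (y + t *\<^sub>R x) - t * p x"
  unfolding sublinear_shift_def
proof (rule cINF_lower)
  show "bdd_below ((\<lambda>t. p (y + t *\<^sub>R x) - t * p x) ` {0..})"
  proof (rule bdd_belowI2)
    fix t :: real assume "t \<in> {0..}"
    then have "t * p x \<le> p (y + t *\<^sub>R x) + p (- y)"
      using sublinear_add[OF p, of "y + t *\<^sub>R x" "- y"] sublinear_scale_eq[OF p, of t x] by simp
    then show "- p (- y) \<le> p (y + t *\<^sub>R x) - t * p x" by simp
  qed
qed (use assms in auto)

lemma sublinear_shift_greatest:
  assumes "\<And>t. 0 \<le> t \<Longrightarrow> c \<le> p (y + t *\<^sub>R x) - t * p x"
  shows "c \<le> sublinear_shift p x y"
  unfolding sublinear_shift_def by (rule cINF_greatest) (use assms in auto)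

text \<open>Parameters \<open>s\<close> for \<open>y\<close> and \<open>t\<close> for
  \<open>z\<close> combine to \<open>s + t\<close> for \<open>y + z\<close>, and \<open>t\<close>
  for \<open>y\<close> becomes \<open>c * t\<close> for \<open>c *\<^sub>R y\<close>. The infima
  over \<open>s\<close> and \<open>t\<close> are then taken one after the other.\<close>

lemma sublinear_sublinear_shift:
  assumes p: "sublinear p"
  shows "sublinear (sublinear_shift p x)"
  unfolding sublinear_def
proof (intro conjI allI impI)
  let ?r = "sublinear_shift p x"
  fix y z
  have *: "?r (y + z) \<le> (p (y + s *\<^sub>R x) - s * p x) + (p (z + t *\<^sub>R x) - t * p x)"
    if "0 \<le> s" "0 \<le> t" for s t
    using sublinear_shift_le[OF p, of "s + t" x "y + z"] that
      sublinear_add[OF p, of "y + s *\<^sub>R x" "z + t *\<^sub>R x"] by (simp add: algebra_simps)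
  have "?r (y + z) - (p (y + s *\<^sub>R x) - s * p x) \<le> ?r z" if "0 \<le> s" for s
    using *[OF that] by (intro sublinear_shift_greatest) (simp add: algebra_simps)
  then have "?r (y + z) - ?r z \<le> ?r y"
    by (intro sublinear_shift_greatest) (simp add: algebra_simps)
  then show "?r (y + z) \<le> ?r y + ?r z" by simp
next
  let ?r = "sublinear_shift p x"
  fix c :: real and y assume c: "0 \<le> c"
  show "?r (c *\<^sub>R y) \<le> c * ?r y"
  proof (cases "c = 0")
    case True
    then show ?thesis
      using sublinear_shift_le[OF p, of 0 x 0] sublinear_zero[OF p] by simp
  next
    case False
    have "?r (c *\<^sub>R y) / c \<le> ?r y"
    proof (rule sublinear_shift_greatest)
      fix t :: real assume "0 \<le> t"
      then have "?r (c *\<^sub>R y) \<le> p (c *\<^sub>R y + (c * t) *\<^sub>R x) - (c * t) * p x"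
        using c by (intro sublinear_shift_le[OF p]) simp
      also have "\<dots> = c * (p (y + t *\<^sub>R x) - t * p x)"
        using sublinear_scale_eq[OF p c, of "y + t *\<^sub>R x"] by (simp add: algebra_simps)
      finally show "?r (c *\<^sub>R y) / c \<le> p (y + t *\<^sub>R x) - t * p x"
        using False c by (simp add: field_simps)
    qed
    then show ?thesis using False c by (simp add: field_simps)
  qed
qed

text \<open>Zorn's lemma for the reversed pointwise order: a nonempty chain has its pointwise
  infimum as lower bound, which is finite because every member is at least \<open>- p (- x)\<close>
  at \<open>x\<close>.\<close>

lemma minimal_sublinear_below:
  fixes p :: "'a::real_vector \<Rightarrow> real"
  assumes "sublinear p"
  obtains q where "sublinear q" "q \<le> p" "\<And>r. sublinear r \<Longrightarrow> r \<le> q \<Longrightarrow> r = q"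
proof -
  define A where "A = {q. sublinear q \<and> q \<le> p}"
  have "\<exists>m\<in>A. \<forall>a\<in>A. m \<ge> a \<longrightarrow> a = m"
  proof (rule predicate_Zorn)
    show "partial_order_on A (relation_of (\<ge>) A)"
      by (rule partial_order_on_relation_ofI) auto
  next
    fix D assume "D \<in> Chains (relation_of (\<ge>) A)"
    then have D: "D \<subseteq> A" "\<And>q r. q \<in> D \<Longrightarrow> r \<in> D \<Longrightarrow> q \<le> r \<or> r \<le> q"
      by (auto simp: Chains_def relation_of_def)
    show "\<exists>u\<in>A. \<forall>a\<in>D. a \<ge> u"
    proof (cases "D = {}")
      case True
      then show ?thesis using assms by (auto simp: A_def)
    next
      case False
      have sub: "sublinear q" "q x \<le> p x" if "q \<in> D" for q x
        using D(1) that by (auto simp: A_def le_fun_def)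
      define u where "u x = (INF q\<in>D. q x)" for x
      have low: "u x \<le> q x" if "q \<in> D" for q x
        unfolding u_def
      proof (rule cINF_lower[OF _ that], rule bdd_belowI2)
        fix r assume "r \<in> D"
        then show "- p (- x) \<le> r x"
          using sublinear_minus[OF sub(1), of r x] sub(2)[of r "- x"] by simp
      qed
      have great: "c \<le> u x" if "\<And>q. q \<in> D \<Longrightarrow> c \<le> q x" for c x
        unfolding u_def using that False by (intro cINF_greatest)
      have "sublinear u"
        unfolding sublinear_def
      proof (intro conjI allI impI)
        fix x y
        \<comment> \<open>The smaller of \<open>q\<close> and \<open>r\<close> satisfies the
          triangle inequality by itself and lies below both; this is where comparability in the
          chain enters.\<close>
        have *: "u (x + y) \<le> q x + r y" if q: "q \<in> D" and r: "r \<in> D" for q r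
        proof (cases "q \<le> r")
          case True
          then show ?thesis
            using low[OF q, of "x + y"] sublinear_add[OF sub(1)[OF q], of x y] le_funD[of q r y]
            by linarith
        next
          case False
          then have "r \<le> q" using D(2)[OF q r] by blast
          then show ?thesis
            using low[OF r, of "x + y"] sublinear_add[OF sub(1)[OF r], of x y] le_funD[of r q x]
            by linarith
        qed
        have "u (x + y) - q x \<le> u y" if "q \<in> D" for q
          by (rule great) (use *[OF that] in \<open>simp add: algebra_simps\<close>)
        then have "u (x + y) - u y \<le> u x"
          by (intro great) (simp add: algebra_simps)
        then show "u (x + y) \<le> u x + u y" by simp
      next
        fix t :: real and x assume t: "0 \<le> t"
        show "u (t *\<^sub>R x) \<le> t * u x"
        proof (cases "t = 0")
          case True
          obtain q where q: "q \<in> D" using \<open>D \<noteq> {}\<close> by blast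
          then show ?thesis
            using low[OF q, of 0] sublinear_zero[OF sub(1)[OF q]] True by simp
        next
          case False
          have "u (t *\<^sub>R x) / t \<le> u x"
          proof (rule great)
            fix q assume q: "q \<in> D"
            show "u (t *\<^sub>R x) / t \<le> q x"
              using low[OF q, of "t *\<^sub>R x"] sublinear_scale[OF sub(1)[OF q] t, of x] False t
              by (simp add: field_simps)
          qed
          then show ?thesis using False t by (simp add: field_simps)
        qed
      qed
      moreover have "u \<le> p"
      proof (rule le_funI)
        fix x
        obtain q where "q \<in> D" using False by blast
        then show "u x \<le> p x" using low[of q x] sub(2)[of q x] by linarith
      qed
      ultimately show ?thesis
        using low by (auto simp: A_def le_fun_def)
    qed
  qed
  then obtain q where "sublinear q" "q \<le> p" "\<And>r. sublinear r \<Longrightarrow> r \<le> p \<Longrightarrow> r \<le> q \<Longrightarrow> r = q"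
    by (auto simp: A_def)
  then show ?thesis using that order_trans by metis
qed

text \<open>The algebraic core of Hahn-Banach. For a minimal \<open>q\<close> the shift lies below
  \<open>q\<close> (take \<open>t = 0\<close>), so it equals \<open>q\<close>; then
  \<open>t = 1\<close> gives \<open>q y + q x \<le> q (y + x)\<close>, and \<open>q\<close> is
  additive.\<close>

lemma linear_below_sublinear:
  fixes p :: "'a::real_vector \<Rightarrow> real"
  assumes "sublinear p"
  obtains f where "linear f" "f \<le> p"
proof -
  obtain q where q: "sublinear q" "q \<le> p" and min: "\<And>r. sublinear r \<Longrightarrow> r \<le> q \<Longrightarrow> r = q"
    using minimal_sublinear_below[OF assms] by blast
  have add: "q (y + x) = q y + q x" for x y
  proof -
    have "sublinear_shift q x \<le> q"
      using sublinear_shift_le[OF q(1), of 0 x] by (simp add: le_fun_def)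
    then have "sublinear_shift q x = q"
      using min sublinear_sublinear_shift[OF q(1)] by blast
    then show ?thesis
      using sublinear_shift_le[OF q(1), of 1 x y] sublinear_add[OF q(1), of y x] by simp
  qed
  have minus: "q (- x) = - q x" for x
    using add[of x "- x"] sublinear_zero[OF q(1)] by simp
  have "linear q"
  proof (rule linearI)
    fix r :: real and x
    show "q (r *\<^sub>R x) = r *\<^sub>R q x"
    proof (cases "0 \<le> r")
      case True
      then show ?thesis using sublinear_scale_eq[OF q(1)] by simp
    next
      case False
      then show ?thesis
        using sublinear_scale_eq[OF q(1), of "- r" x] minus[of "r *\<^sub>R x"] by simp
    qed
  qed (rule add)
  then show ?thesis using that q(2) by blast
qed

text \<open>A linear \<open>f\<close> below the shift of the norm is below the norm
  (\<open>t = 0\<close>), and \<open>f (- x) \<le> - norm x\<close> (\<open>t = 1\<close>). The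
  functional is real-linear, whatever the scalar field.\<close>

lemma norming_functional:
  fixes x :: "'a::real_normed_vector"
  obtains f :: "'a \<Rightarrow> real" where "bounded_linear f" "f x = norm x" "\<And>y. \<bar>f y\<bar> \<le> norm y"
proof -
  obtain f where f: "linear f" "f \<le> sublinear_shift norm x"
    using linear_below_sublinear[OF sublinear_sublinear_shift[OF sublinear_norm]] .
  have le: "f y \<le> norm y" for y
    using le_funD[OF f(2), of y] sublinear_shift_le[OF sublinear_norm, of 0 x y] by simp
  have minus: "f (- y) = - f y" for y
    using linear_neg[OF f(1)] .
  have "f (- x) \<le> - norm x"
    using le_funD[OF f(2), of "- x"] sublinear_shift_le[OF sublinear_norm, of 1 x "- x"] by simp
  then have "f x = norm x"
    using le[of x] minus[of x] by simp
  moreover have *: "\<bar>f y\<bar> \<le> norm y" for y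
    using le[of y] le[of "- y"] minus[of y] by simp
  moreover have "bounded_linear f"
    using * by (intro bounded_linear_intro[of f 1]) (simp_all add: linear_add[OF f(1)] linear_cmul[OF f(1)])
  ultimately show ?thesis using that by blast
qed

section \<open>Finite-rank perturbations and the sign of the index\<close>

text \<open>Here \<open>span\<close> is the real span: the index is handled in the underlying real
  space, and the scalar field enters only with approximate eigenspaces.\<close>

definition finite_rank :: "('a::real_normed_vector \<Rightarrow> 'b::real_normed_vector) \<Rightarrow> bool" where
  "finite_rank F \<longleftrightarrow> bounded_linear F \<and> (\<exists>B. finite B \<and> range F \<subseteq> span B)"

lemma finite_rank_zero: "finite_rank (\<lambda>x. 0)"
  by (auto simp: finite_rank_def)

lemma finite_rank_add:
  assumes "finite_rank F" "finite_rank G"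
  shows "finite_rank (\<lambda>x. F x + G x)"
proof -
  obtain B D where "finite B" "finite D" "range F \<subseteq> span B" "range G \<subseteq> span D"
    using assms by (auto simp: finite_rank_def)
  then have "finite (B \<union> D)" "range (\<lambda>x. F x + G x) \<subseteq> span (B \<union> D)"
    using span_mono[of B "B \<union> D"] span_mono[of D "B \<union> D"] by (auto intro!: span_add)
  moreover have "bounded_linear (\<lambda>x. F x + G x)"
    using assms by (auto simp: finite_rank_def intro: bounded_linear_add)
  ultimately show ?thesis
    unfolding finite_rank_def by metis
qed

lemma finite_rank_minus:
  assumes "finite_rank F" shows "finite_rank (\<lambda>x. - F x)"
  using assms by (force simp: finite_rank_def intro: bounded_linear_minus span_neg)

lemma finite_rank_rank_one:
  assumes "bounded_linear f" shows "finite_rank (\<lambda>x. f x *\<^sub>R g)"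
  unfolding finite_rank_def
proof (intro conjI exI[of _ "{g}"])
  show "bounded_linear (\<lambda>x. f x *\<^sub>R g)"
    using bounded_linear_compose[OF bounded_linear_scaleR_left assms] .
qed (auto simp: span_singleton)

text \<open>A linear right inverse \<open>h\<close> of \<open>g\<close> on \<open>M\<close> sends a
  basis to an independent set of equal size, so its image is all of \<open>M\<close>. Thus
  \<open>x = h y\<close> for some \<open>y\<close> in \<open>M\<close>, and
  \<open>y = g x = 0\<close>.\<close>

lemma surjective_on_finite_dim_imp_injective:
  fixes g :: "'a::real_vector \<Rightarrow> 'a"
  assumes g: "linear g" and M: "subspace M" "M \<subseteq> span B" "finite B" "M \<subseteq> g ` M"
    and x: "x \<in> M" "g x = 0"
  shows "x = 0"
proof -
  obtain A where A: "A \<subseteq> M" "independent A" "M \<subseteq> span A"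
    using maximal_independent_subset[of M] by blast
  have fin: "finite A"
    using independent_span_bound[OF M(3) A(2)] A(1) M(2) by blast
  have spanA: "span A = M"
    using A M(1) span_minimal[of A M] by blast
  have sp: "span A \<subseteq> g ` span A"
    using spanA M(4) by simp
  obtain h where h: "range h \<subseteq> span A" "linear h" "\<And>v. v \<in> M \<Longrightarrow> g (h v) = v"
    using linear_surj_right_inverse[OF g sp] spanA by auto
  have inj: "inj_on h (span A)"
    using h(3) spanA by (metis inj_onI)
  have indep: "independent (h ` A)"
    using linear_independent_injective_image[OF h(2) A(2) inj] .
  have card: "card (h ` A) = card A"
    using card_image inj_on_subset[OF inj span_superset] by blast
  have "x \<in> span (h ` A)"
  proof (rule ccontr)
    assume x': "x \<notin> span (h ` A)"
    have 1: "independent (insert x (h ` A))"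
      by (rule independent_insertI[OF x' indep])
    have 2: "insert x (h ` A) \<subseteq> span A"
      using h(1) x(1) spanA by auto
    have "card (insert x (h ` A)) \<le> card A"
      by (rule conjunct2[OF independent_span_bound[OF fin 1 2]])
    moreover have "x \<notin> h ` A"
      using x' span_base[of x "h ` A"] by metis
    ultimately show False
      using card fin by simp
  qed
  then obtain y where "y \<in> M" "x = h y"
    using linear_span_image[OF h(2), of A] spanA by auto
  then show ?thesis
    using h(3) x(2) linear_0[OF h(2)] by force
qed

text \<open>With a linear left inverse \<open>L\<close> of \<open>S\<close>, the map \<open>I + L F\<close> sends the finite-dimensional space
  \<open>range (L F)\<close> onto itself, hence is injective there; but if \<open>S\<close> is not onto, \<open>L\<close> kills some
  \<open>y \<noteq> 0\<close>, and a preimage of \<open>y\<close> under \<open>S + F\<close> lies in the kernel of \<open>I + L F\<close>.\<close>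

lemma injective_surjective_finite_rank_perturbation:
  fixes S F :: "'a::real_normed_vector \<Rightarrow> 'a"
  assumes S: "linear S" "inj S" and F: "finite_rank F" and surj: "surj (\<lambda>x. S x + F x)"
  shows "surj S"
proof (rule ccontr)
  assume "\<not> surj S"
  then obtain y1 where y1: "y1 \<notin> range S" by auto
  obtain L where L: "linear L" "\<And>x. L (S x) = x"
    using linear_injective_left_inverse[OF S] by (auto simp: fun_eq_iff)
  define y where "y = y1 - S (L y1)"
  have y: "y \<noteq> 0" "L y = 0"
    using y1 by (auto simp: y_def linear_diff[OF L(1)] L(2))
  obtain B where B: "finite B" "range F \<subseteq> span B"
    using F by (auto simp: finite_rank_def)
  have linF: "linear F"
    using F bounded_linear.linear by (auto simp: finite_rank_def)
  define M where "M = L ` range F"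
  define g where "g x = x + L (F x)" for x
  have LF: "linear (\<lambda>x. L (F x))"
    using linear_compose[OF linF L(1)] by (simp add: o_def)
  have M: "subspace M" "M \<subseteq> span (L ` B)"
    unfolding M_def using linear_subspace_image[OF L(1) linear_subspace_image[OF linF subspace_UNIV]]
      B(2) linear_span_image[OF L(1), of B] by auto
  have LS: "L (S x + F x) = g x" for x
    by (simp add: linear_add[OF L(1)] L(2) g_def)
  \<comment> \<open>Applying \<open>L\<close> to \<open>S m = S x + F x\<close> gives
    \<open>m = x + L (F x)\<close>, so the preimage \<open>x\<close> differs from \<open>m\<close>
    by an element of \<open>M\<close> and lies in \<open>M\<close> itself.\<close>
  have "m \<in> g ` M" if "m \<in> M" for m
  proof -
    obtain x where x: "S m = S x + F x"
      using surjD[OF surj, of "S m"] by blast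
    have gx: "g x = m"
      using LS[of x] L(2)[of m] unfolding x[symmetric] by simp
    have "m - L (F x) \<in> M"
      by (intro subspace_diff[OF M(1) that]) (simp add: M_def)
    then have "x \<in> M"
      using gx by (simp add: g_def flip: gx)
    then show ?thesis
      using gx by blast
  qed
  then have gM: "M \<subseteq> g ` M" by blast
  have "linear g"
    unfolding g_def by (intro linear_compose_add linear_ident LF)
  obtain x where x: "y = S x + F x"
    using surjD[OF surj, of y] by blast
  have gx: "g x = 0"
    using LS[of x] y(2) unfolding x[symmetric] by simp
  have "- L (F x) \<in> M"
    by (intro subspace_neg[OF M(1)]) (simp add: M_def)
  moreover have "- L (F x) = x"
    using gx unfolding g_def by (metis add.commute minus_unique minus_minus)
  ultimately have "x \<in> M" by simp
  then have "x = 0"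
    by (rule surjective_on_finite_dim_imp_injective[OF \<open>linear g\<close> M finite_imageI[OF B(1)] gM _ gx])
  then show False
    using x y(1) linear_0[OF S(1)] linear_0[OF linF] by simp
qed

section \<open>Stability of lower bounds and of surjectivity under small perturbations\<close>

definition bounded_below_on :: "'a set \<Rightarrow> ('a::real_normed_vector \<Rightarrow> 'b::real_normed_vector) \<Rightarrow> bool" where
  "bounded_below_on W S \<longleftrightarrow> (\<exists>c>0. \<forall>x\<in>W. c * norm x \<le> norm (S x))"

definition boundedly_surjective :: "('a::real_normed_vector \<Rightarrow> 'b::real_normed_vector) \<Rightarrow> bool" where
  "boundedly_surjective S \<longleftrightarrow> (\<exists>K\<ge>0. \<forall>y. \<exists>x. S x = y \<and> norm x \<le> K * norm y)"

lemma boundedly_surjective_imp_surj: "boundedly_surjective S \<Longrightarrow> surj S"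
  unfolding boundedly_surjective_def surj_def by metis

lemma bounded_below_imp_inj:
  assumes "linear S" "bounded_below_on UNIV S"
  shows "inj S"
proof -
  obtain c where c: "0 < c" "\<And>x. c * norm x \<le> norm (S x)"
    using assms(2) by (auto simp: bounded_below_on_def)
  have "x = 0" if "S x = 0" for x
    using c(2)[of x] c(1) that by (simp add: mult_le_0_iff)
  then show ?thesis
    using linear_injective_0[OF assms(1)] by blast
qed

lemma surj_bounded_below:
  assumes "0 < c" "\<And>x. x \<in> W \<Longrightarrow> c * norm x \<le> norm (S x)" "S ` W = UNIV"
  shows "\<exists>x. S x = y \<and> norm x \<le> inverse c * norm y"
proof -
  obtain x where "x \<in> W" "y = S x" using assms(3) by blast
  then show ?thesis
    using assms(1) assms(2)[of x] by (auto simp: field_simps intro!: exI[of _ x])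
qed

text \<open>Successive correction: solve \<open>S x = y\<close>, then solve again for the error
  caused by \<open>B\<close>, and so on. The errors decay geometrically with ratio
  \<open>K * d\<close>, and completeness sums the corrections.\<close>

lemma boundedly_surjective_perturbation:
  fixes S B :: "'a::banach \<Rightarrow> 'b::real_normed_vector"
  assumes S: "bounded_linear S" and B: "bounded_linear B"
    and K: "0 \<le> K" "\<And>y. \<exists>x. S x = y \<and> norm x \<le> K * norm y"
    and d: "0 \<le> d" "\<And>x. norm (B x) \<le> d * norm x" and Kd: "K * d < 1"
  shows "boundedly_surjective (\<lambda>x. S x + B x)"
proof -
  obtain g where g: "\<And>y. S (g y) = y" "\<And>y. norm (g y) \<le> K * norm y"
    using K(2) by metis
  define q where "q = K * d"
  have q: "0 \<le> q" "q < 1" using K d Kd by (auto simp: q_def)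
  have "\<exists>x. S x + B x = y \<and> norm x \<le> K * inverse (1 - q) * norm y" for y
  proof -
    \<comment> \<open>\<open>Y n\<close> is the error left after \<open>n\<close> corrections and
      \<open>x n\<close> the next correction. As \<open>S (x n) = Y n\<close> and
      \<open>B (x n) = - Y (Suc n)\<close>, the sum telescopes to \<open>y\<close>.\<close>
    define Y where "Y n = ((\<lambda>z. - B (g z)) ^^ n) y" for n
    define x where "x n = g (Y n)" for n
    have Y: "Y 0 = y" "Y (Suc n) = - B (x n)" for n
      by (simp_all add: Y_def x_def)
    have nY: "norm (Y n) \<le> q ^ n * norm y" for n
    proof (induction n)
      case (Suc n)
      have "norm (Y (Suc n)) \<le> d * (K * norm (Y n))"
        using d(2)[of "x n"] mult_left_mono[OF g(2)[of "Y n"] d(1)] by (simp add: Y x_def)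
      also have "\<dots> = q * norm (Y n)" by (simp add: q_def)
      also have "\<dots> \<le> q * (q ^ n * norm y)"
        by (rule mult_left_mono[OF Suc.IH q(1)])
      finally show ?case by simp
    qed (simp add: Y)
    have nx: "norm (x n) \<le> K * norm y * q ^ n" for n
      using g(2)[of "Y n"] mult_left_mono[OF nY[of n] K(1)] by (simp add: x_def ac_simps)
    have sg: "(\<lambda>n. K * norm y * q ^ n) sums (K * norm y * (1 / (1 - q)))"
      using q by (intro sums_mult geometric_sums) simp
    have sx: "summable x"
      by (rule summable_comparison_test'[OF sums_summable[OF sg] nx])
    have Sx: "S (x n) = Y n" for n by (simp add: x_def g)
    have Bx: "B (x n) = - Y (Suc n)" for n by (simp add: Y)
    have sY: "summable Y"
      using bounded_linear.summable[OF S sx] by (simp add: Sx)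
    have "S (suminf x) = suminf Y"
      using bounded_linear.suminf[OF S sx] by (simp add: Sx)
    moreover have "B (suminf x) = - (suminf Y - y)"
      using bounded_linear.suminf[OF B sx] suminf_split_head[OF sY] suminf_minus[of "\<lambda>n. Y (Suc n)"]
        sY summable_Suc_iff[of Y] by (simp add: Bx Y(1))
    moreover have "norm (suminf x) \<le> K * norm y * (1 / (1 - q))"
      using norm_suminf_le[OF nx sums_summable[OF sg]] sums_unique[OF sg] by simp
    ultimately show ?thesis
      by (intro exI[of _ "suminf x"]) (simp add: field_simps)
  qed
  moreover have "0 \<le> K * inverse (1 - q)"
    using K q by simp
  ultimately show ?thesis
    unfolding boundedly_surjective_def by blast
qed

text \<open>For a semi-Fredholm operator the sign of the index is read off a finite-rank perturbation
  which is injective or surjective.\<close>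

definition negative_index :: "('a::real_normed_vector \<Rightarrow> 'a) \<Rightarrow> bool" where
  "negative_index A \<longleftrightarrow>
     (\<exists>F. finite_rank F \<and> bounded_below_on UNIV (\<lambda>x. A x + F x) \<and> \<not> surj (\<lambda>x. A x + F x))"

definition nonnegative_index :: "('a::real_normed_vector \<Rightarrow> 'a) \<Rightarrow> bool" where
  "nonnegative_index A \<longleftrightarrow> (\<exists>F. finite_rank F \<and> boundedly_surjective (\<lambda>x. A x + F x))"

lemma finite_rank_bounded_linear: "finite_rank F \<Longrightarrow> bounded_linear F"
  by (simp add: finite_rank_def)

text \<open>The difference of the two finite-rank perturbations would turn an injective,
  non-surjective operator into a surjective one.\<close>

lemma not_negative_and_nonnegative_index:
  assumes A: "bounded_linear A" and "negative_index A"
  shows "\<not> nonnegative_index A"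
proof
  assume "nonnegative_index A"
  then obtain G where G: "finite_rank G" "surj (\<lambda>x. A x + G x)"
    unfolding nonnegative_index_def using boundedly_surjective_imp_surj by blast
  obtain F where F: "finite_rank F" "bounded_below_on UNIV (\<lambda>x. A x + F x)"
      "\<not> surj (\<lambda>x. A x + F x)"
    using assms(2) unfolding negative_index_def by blast
  let ?S = "\<lambda>x. A x + F x"
  have "linear ?S"
    using bounded_linear_add[OF A finite_rank_bounded_linear[OF F(1)]] bounded_linear.linear by blast
  moreover have "inj ?S"
    using bounded_below_imp_inj[OF calculation F(2)] .
  moreover have "finite_rank (\<lambda>x. G x + - F x)"
    using finite_rank_add[OF G(1) finite_rank_minus[OF F(1)]] .
  moreover have "surj (\<lambda>x. ?S x + (G x + - F x))"
    using G(2) by (simp add: algebra_simps)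
  ultimately have "surj ?S"
    by (rule injective_surjective_finite_rank_perturbation)
  then show False using F(3) by blast
qed

text \<open>The same \<open>F\<close> serves for \<open>A + B\<close>: the lower bound survives, and
  if surjectivity appeared, subtracting the small \<open>B\<close> again would make
  \<open>A + F\<close> surjective.\<close>

lemma negative_index_perturbation:
  fixes A :: "'a::banach \<Rightarrow> 'a"
  assumes A: "bounded_linear A" and "negative_index A"
  obtains d where "0 < d" "\<And>B. bounded_linear B \<Longrightarrow> (\<And>x. norm (B x) \<le> d * norm x) \<Longrightarrow>
      negative_index (\<lambda>x. A x + B x)"
proof -
  obtain F c where F: "finite_rank F" "\<not> surj (\<lambda>x. A x + F x)"
      and c: "0 < c" "\<And>x. c * norm x \<le> norm (A x + F x)"
    using assms(2) unfolding negative_index_def bounded_below_on_def by blast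
  \<comment> \<open>With \<open>c / 3\<close> the lower bound drops to \<open>2 * c / 3\<close>, so
    preimages cost at most \<open>3 / (2 * c)\<close> and undoing \<open>B\<close> has ratio
    \<open>1/2\<close>.\<close>
  have "negative_index (\<lambda>x. A x + B x)"
    if B: "bounded_linear B" "\<And>x. norm (B x) \<le> c / 3 * norm x" for B
  proof -
    let ?S = "\<lambda>x. A x + B x + F x"
    have below: "(2 * c / 3) * norm x \<le> norm (?S x)" for x
      using c(2)[of x] B(2)[of x] norm_triangle_ineq4[of "?S x" "B x"] by (simp add: algebra_simps)
    have "\<not> surj ?S"
    proof
      assume "surj ?S"
      then have ex: "\<exists>x. ?S x = y \<and> norm x \<le> inverse (2 * c / 3) * norm y" for y
        using surj_bounded_below[of "2 * c / 3" UNIV ?S y] below c(1) by simp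
      have "bounded_linear ?S"
        by (intro bounded_linear_add A B(1) finite_rank_bounded_linear[OF F(1)])
      then have "boundedly_surjective (\<lambda>x. ?S x + - B x)"
        using c(1) B(2)
        by (intro boundedly_surjective_perturbation[OF _ bounded_linear_minus[OF B(1)] _ ex, of "c / 3"]) auto
      then show False
        using F(2) boundedly_surjective_imp_surj[of "\<lambda>x. A x + F x"] by (simp add: algebra_simps)
    qed
    then show ?thesis
      unfolding negative_index_def bounded_below_on_def
      using F(1) below c(1) by (intro exI[of _ F] conjI exI[of _ "2 * c / 3"]) auto
  qed
  then show ?thesis
    using that[of "c / 3"] c(1) by simp
qed

lemma nonnegative_index_perturbation:
  fixes A :: "'a::banach \<Rightarrow> 'a"
  assumes A: "bounded_linear A" and "nonnegative_index A"
  obtains d where "0 < d" "\<And>B. bounded_linear B \<Longrightarrow> (\<And>x. norm (B x) \<le> d * norm x) \<Longrightarrow>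
      nonnegative_index (\<lambda>x. A x + B x)"
proof -
  obtain F K where F: "finite_rank F"
      and K: "0 \<le> K" "\<And>y. \<exists>x. A x + F x = y \<and> norm x \<le> K * norm y"
    using assms(2) unfolding nonnegative_index_def boundedly_surjective_def by blast
  define d where "d = 1 / (K + 1)"
  have d: "0 < d" "K * d < 1" using K(1) by (auto simp: d_def)
  have "nonnegative_index (\<lambda>x. A x + B x)"
    if B: "bounded_linear B" "\<And>x. norm (B x) \<le> d * norm x" for B
  proof -
    have "bounded_linear (\<lambda>x. A x + F x)"
      by (intro bounded_linear_add A finite_rank_bounded_linear[OF F])
    then have "boundedly_surjective (\<lambda>x. (A x + F x) + B x)"
      using d(1) by (intro boundedly_surjective_perturbation[OF _ B(1) K _ B(2) d(2)]) auto
    then show ?thesis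
      unfolding nonnegative_index_def using F by (intro exI[of _ F]) (simp add: algebra_simps)
  qed
  then show ?thesis
    using that d(1) by blast
qed

section \<open>Operators bounded below on a subspace of finite codimension\<close>

definition annihilator :: "('a::real_vector \<Rightarrow> real) set \<Rightarrow> 'a set" where
  "annihilator \<Phi> = {x. \<forall>f\<in>\<Phi>. f x = 0}"

lemma subspace_annihilator:
  assumes "\<And>f. f \<in> \<Phi> \<Longrightarrow> linear f"
  shows "subspace (annihilator \<Phi>)"
  using assms by (auto simp: subspace_def annihilator_def linear_0 linear_add linear_cmul)

lemma closed_annihilator:
  assumes "\<And>f. f \<in> \<Phi> \<Longrightarrow> bounded_linear f"
  shows "closed (annihilator \<Phi>)"
proof -
  have "annihilator \<Phi> = (\<Inter>f\<in>\<Phi>. {x. f x = 0})"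
    by (auto simp: annihilator_def)
  moreover have "closed {x. f x = 0}" if "f \<in> \<Phi>" for f
    using assms[OF that] by (intro closed_Collect_eq linear_continuous_on continuous_on_const)
  ultimately show ?thesis by auto
qed

lemma negative_or_nonnegative_index:
  fixes A :: "'a::banach \<Rightarrow> 'a"
  assumes "finite \<Phi>" "\<And>f. f \<in> \<Phi> \<Longrightarrow> bounded_linear f" "bounded_linear A"
    "bounded_below_on (annihilator \<Phi>) A"
  shows "negative_index A \<or> nonnegative_index A"
  using assms
proof (induction \<Phi> arbitrary: A rule: finite_induct)
  case empty
  have below: "bounded_below_on UNIV A" using empty.prems by (simp add: annihilator_def)
  show ?case
  proof (cases "surj A")
    case True
    obtain c where c: "0 < c" "\<And>x. c * norm x \<le> norm (A x)"
      using below by (auto simp: bounded_below_on_def)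
    then have "boundedly_surjective A"
      unfolding boundedly_surjective_def
      using surj_bounded_below[of c UNIV A] True by (intro exI[of _ "inverse c"]) simp
    then have "nonnegative_index A"
      unfolding nonnegative_index_def using finite_rank_zero by (intro exI[of _ "\<lambda>x. 0"]) simp
    then show ?thesis ..
  next
    case False
    then have "negative_index A"
      unfolding negative_index_def using finite_rank_zero below by (intro exI[of _ "\<lambda>x. 0"]) simp
    then show ?thesis ..
  qed
next
  case (insert f \<Phi>)
  let ?W = "annihilator \<Phi>" and ?W' = "annihilator (insert f \<Phi>)"
  have f: "bounded_linear f" using insert.prems by blast
  obtain c where c: "0 < c" "\<And>x. x \<in> ?W' \<Longrightarrow> c * norm x \<le> norm (A x)"
    using insert.prems(3) by (auto simp: bounded_below_on_def)
  consider "\<forall>u\<in>?W. f u = 0" | "A ` ?W' = UNIV" | "\<exists>u\<in>?W. f u \<noteq> 0" "A ` ?W' \<noteq> UNIV" by blast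
  then show ?case
  proof cases
    case 1
    then have "?W' = ?W" by (auto simp: annihilator_def)
    then show ?thesis using insert by simp
  next
    case 2
    then have "boundedly_surjective A"
      unfolding boundedly_surjective_def
      using surj_bounded_below[OF c 2] c(1) by (intro exI[of _ "inverse c"]) simp
    then have "nonnegative_index A"
      unfolding nonnegative_index_def using finite_rank_zero by (intro exI[of _ "\<lambda>x. 0"]) simp
    then show ?thesis ..
  next
    case 3
    interpret f: bounded_linear f by fact
    interpret A: bounded_linear A by fact
    have W: "subspace ?W" "subspace ?W'"
      using insert.prems(1) bounded_linear.linear by (blast intro: subspace_annihilator)+
    obtain u0 where u0: "u0 \<in> ?W" "f u0 \<noteq> 0" using 3 by blast
    define u where "u = inverse (f u0) *\<^sub>R u0"
    have u: "u \<in> ?W" "f u = 1"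
      using u0 W(1) by (auto simp: u_def f.scaleR subspace_scale)
    obtain g where g: "g \<notin> A ` ?W'" using 3 by blast
    have "complete ?W'"
      using closed_annihilator[of "insert f \<Phi>"] insert.prems(1) complete_eq_closed by blast
    then have "complete (A ` ?W')"
      by (intro complete_isometric_image[OF c(1) W(2) insert.prems(2)]) (use c(2) in auto)
    then have clo: "closed (A ` ?W')" by (rule complete_imp_closed)
    have ne: "A ` ?W' \<noteq> {}" using subspace_0[OF W(2)] by blast
    \<comment> \<open>The image of a complete space under a map bounded below is closed, so
      \<open>g\<close> has positive distance from it; scaling yields \<open>dist\<close>.\<close>
    define \<delta> where "\<delta> = infdist g (A ` ?W')"
    have \<delta>: "0 < \<delta>"
      using infdist_pos_not_in_closed[OF clo ne g] by (simp add: \<delta>_def)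
    have dist: "\<delta> * \<bar>t\<bar> \<le> norm (A w + t *\<^sub>R g)" if w: "w \<in> ?W'" for w t
    proof (cases "t = 0")
      case False
      have "(- inverse t) *\<^sub>R w \<in> ?W'" using W(2) w by (simp only: subspace_scale)
      then have "\<delta> \<le> dist g (A ((- inverse t) *\<^sub>R w))"
        unfolding \<delta>_def by (intro infdist_le imageI)
      then have "\<delta> \<le> norm (g + inverse t *\<^sub>R A w)"
        by (simp add: dist_norm A.scaleR A.neg)
      then have "\<bar>t\<bar> * \<delta> \<le> \<bar>t\<bar> * norm (g + inverse t *\<^sub>R A w)"
        by (intro mult_left_mono) auto
      also have "\<dots> = norm (t *\<^sub>R (g + inverse t *\<^sub>R A w))" by simp
      also have "t *\<^sub>R (g + inverse t *\<^sub>R A w) = A w + t *\<^sub>R g"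
        using False by (simp add: scaleR_add_right)
      finally show ?thesis by (simp add: mult.commute)
    qed simp
    define A' where "A' x = A x + f x *\<^sub>R (g - A u)" for x
    have A': "bounded_linear A'"
      unfolding A'_def
      by (intro bounded_linear_add insert.prems(2) bounded_linear_compose[OF bounded_linear_scaleR_left f])
    \<comment> \<open>Split \<open>x = w + f x *\<^sub>R u\<close> with \<open>w\<close> in
      \<open>?W'\<close>. Then \<open>dist\<close> bounds \<open>f x\<close> by
      \<open>norm (A' x) / \<delta>\<close>, and the lower bound \<open>c\<close> for
      \<open>A\<close> controls \<open>w\<close>.\<close>
    define M where "M = (1 + norm g / \<delta>) / c + norm u / \<delta>"
    have M: "0 < M"
      unfolding M_def using c(1) \<delta> by (intro add_pos_nonneg divide_pos_pos) auto
    have "norm x \<le> M * norm (A' x)" if x: "x \<in> ?W" for x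
    proof -
      define w where "w = x - f x *\<^sub>R u"
      have "w \<in> ?W" unfolding w_def using W(1) x u(1) by (simp only: subspace_diff subspace_scale)
      then have w: "w \<in> ?W'"
        using u(2) by (simp add: annihilator_def) (simp add: w_def f.diff f.scaleR)
      have A'x: "A' x = A w + f x *\<^sub>R g"
        by (simp add: A'_def w_def A.diff A.scaleR scaleR_diff_right)
      have fx: "\<bar>f x\<bar> \<le> norm (A' x) / \<delta>"
        using dist[OF w, of "f x"] \<delta> by (simp add: A'x field_simps)
      have "norm (A w) \<le> norm (A' x) + \<bar>f x\<bar> * norm g"
        using norm_triangle_ineq4[of "A' x" "f x *\<^sub>R g"] by (simp add: A'x)
      also have "\<dots> \<le> norm (A' x) + norm (A' x) / \<delta> * norm g"
        using mult_right_mono[OF fx norm_ge_zero[of g]] by simp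
      finally have "norm w \<le> (norm (A' x) + norm (A' x) / \<delta> * norm g) / c"
        using c(2)[OF w] c(1) by (simp add: field_simps)
      moreover have "norm x \<le> norm w + \<bar>f x\<bar> * norm u"
        using norm_triangle_ineq[of w "f x *\<^sub>R u"] by (simp add: w_def)
      moreover have "\<bar>f x\<bar> * norm u \<le> norm (A' x) / \<delta> * norm u"
        using mult_right_mono[OF fx norm_ge_zero[of u]] .
      ultimately have "norm x \<le> (norm (A' x) + norm (A' x) / \<delta> * norm g) / c + norm (A' x) / \<delta> * norm u"
        by linarith
      also have "\<dots> = M * norm (A' x)"
        by (simp add: M_def algebra_simps add_divide_distrib)
      finally show ?thesis .
    qed
    then have "bounded_below_on ?W A'"
      unfolding bounded_below_on_def using M
      by (intro exI[of _ "inverse M"]) (simp add: field_simps)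
    then have "negative_index A' \<or> nonnegative_index A'"
      using insert.IH[OF _ A'] insert.prems(1) by blast
    moreover have fr: "finite_rank (\<lambda>x. f x *\<^sub>R (g - A u) + F x)" if "finite_rank F" for F
      by (intro finite_rank_add finite_rank_rank_one f that)
    have eq: "A' x + F x = A x + (f x *\<^sub>R (g - A u) + F x)" for F :: "'a \<Rightarrow> 'a" and x
      by (simp add: A'_def)
    ultimately show ?thesis
      unfolding negative_index_def nonnegative_index_def eq using fr by blast
  qed
qed

text \<open>Otherwise the index of \<open>T - t\<close> would be constant in \<open>t \<ge> 0\<close>, whereas it is negative for
  \<open>t = 0\<close> and zero for large \<open>t\<close>.\<close>

lemma ex_not_bounded_below_shift:
  fixes T :: "'a::banach \<Rightarrow> 'a"
  assumes T: "bounded_linear T" "bounded_below_on UNIV T" "\<not> surj T"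
  shows "\<exists>t\<ge>0. \<forall>\<Phi>. finite \<Phi> \<longrightarrow> (\<forall>f\<in>\<Phi>. bounded_linear f) \<longrightarrow>
      \<not> bounded_below_on (annihilator \<Phi>) (\<lambda>x. T x - t *\<^sub>R x)"
proof (rule ccontr)
  assume "\<not> ?thesis"
  then have ex: "\<exists>\<Phi>. finite \<Phi> \<and> (\<forall>f\<in>\<Phi>. bounded_linear f) \<and>
      bounded_below_on (annihilator \<Phi>) (\<lambda>x. T x - t *\<^sub>R x)" if "0 \<le> t" for t
    using that by blast
  let ?A = "\<lambda>t x. T x - t *\<^sub>R x"
  have A: "bounded_linear (?A t)" for t
    by (intro bounded_linear_sub T(1) bounded_linear_scaleR_right)
  \<comment> \<open>\<open>P\<close> and \<open>N\<close> are open and disjoint, cover the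
    half-line, and contain \<open>0\<close> and \<open>K + 1\<close> respectively; connectedness
    forbids this.\<close>
  define P where "P = {t. negative_index (?A t)}"
  define N where "N = {t. nonnegative_index (?A t)}"
  have shift: "?A s = (\<lambda>x. ?A t x + (t - s) *\<^sub>R x)" for s t
    by (auto simp: algebra_simps)
  have "open P"
    unfolding open_dist
  proof
    fix t assume "t \<in> P"
    then obtain d where d: "0 < d" "\<And>B. bounded_linear B \<Longrightarrow> (\<And>x. norm (B x) \<le> d * norm x) \<Longrightarrow>
        negative_index (\<lambda>x. ?A t x + B x)"
      using negative_index_perturbation[OF A] unfolding P_def by blast
    have "s \<in> P" if "dist s t < d" for s
      unfolding P_def mem_Collect_eq shift[of s t]
      by (rule d(2)) (use that in \<open>auto simp: dist_real_def bounded_linear_scaleR_right intro!: mult_right_mono\<close>)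
    then show "\<exists>e>0. \<forall>s. dist s t < e \<longrightarrow> s \<in> P" using d(1) by blast
  qed
  moreover have "open N"
    unfolding open_dist
  proof
    fix t assume "t \<in> N"
    then obtain d where d: "0 < d" "\<And>B. bounded_linear B \<Longrightarrow> (\<And>x. norm (B x) \<le> d * norm x) \<Longrightarrow>
        nonnegative_index (\<lambda>x. ?A t x + B x)"
      using nonnegative_index_perturbation[OF A] unfolding N_def by blast
    have "s \<in> N" if "dist s t < d" for s
      unfolding N_def mem_Collect_eq shift[of s t]
      by (rule d(2)) (use that in \<open>auto simp: dist_real_def bounded_linear_scaleR_right intro!: mult_right_mono\<close>)
    then show "\<exists>e>0. \<forall>s. dist s t < e \<longrightarrow> s \<in> N" using d(1) by blast
  qed
  moreover have "P \<inter> N = {}"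
    using not_negative_and_nonnegative_index[OF A] by (auto simp: P_def N_def)
  moreover have "{0..} \<subseteq> P \<union> N"
    using ex negative_or_nonnegative_index[OF _ _ A] by (fastforce simp: P_def N_def)
  moreover have "0 \<in> P"
    unfolding P_def negative_index_def using T finite_rank_zero by (auto intro!: exI[of _ "\<lambda>x. 0"])
  moreover obtain K where K: "0 < K" "\<And>x. norm (T x) \<le> norm x * K"
    using bounded_linear.pos_bounded[OF T(1)] by blast
  have "K + 1 \<in> N"
  proof -
    \<comment> \<open>\<open>T\<close> is a perturbation of an invertible multiple of the identity,
      with ratio \<open>K / (K + 1) < 1\<close>.\<close>
    have "boundedly_surjective (\<lambda>x. (- (K + 1)) *\<^sub>R x + T x)"
    proof (rule boundedly_surjective_perturbation[OF bounded_linear_scaleR_right T(1)])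
      show "\<exists>x. (- (K + 1)) *\<^sub>R x = y \<and> norm x \<le> inverse (K + 1) * norm y" for y :: 'a
        using K(1) by (intro exI[of _ "(- inverse (K + 1)) *\<^sub>R y"]) (simp del: minus_add_distrib)
      show "inverse (K + 1) * K < 1" using K(1) by (simp add: field_simps)
    qed (use K in \<open>auto simp: mult.commute\<close>)
    then show ?thesis
      unfolding N_def nonnegative_index_def
      using finite_rank_zero by (auto intro!: exI[of _ "\<lambda>x. 0"] simp: algebra_simps)
  qed
  moreover have "0 \<le> K + 1" using K(1) by simp
  ultimately show False
    using connectedD[OF connected_Ici[of "0::real"], of P N] by auto
qed

section \<open>Approximate eigenspaces\<close>

text \<open>The scalar \<open>j\<close> corresponds to the imaginary unit; over the reals
  \<open>t = 0\<close> suffices. With it, a real functional vanishes on all scalar multiples of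
  \<open>x\<close> as soon as it vanishes on \<open>x\<close> and \<open>scale j x\<close>.\<close>

lemma real_or_complex_generator:
  "\<exists>j :: 'k::real_or_complex. \<forall>k. \<exists>s t. k = of_real s + of_real t * j"
proof -
  obtain f :: "'k \<Rightarrow> complex" where f: "\<And>x y. f (x + y) = f x + f y" "\<And>x y. f (x * y) = f x * f y"
      "\<And>r x. f (r *\<^sub>R x) = r *\<^sub>R f x" "\<And>x. norm (f x) = norm x" and range: "range f = \<real> \<or> range f = UNIV"
    using ex_iso_real_or_complex[where 'a = 'k] by blast
  have "f (x - y) = f x - f y" for x y
    using f(1)[of x "(-1) *\<^sub>R y"] f(3)[of "-1" y] by simp
  then have inj: "f x = f y \<Longrightarrow> x = y" for x y
    using f(4)[of "x - y"] by simp
  have "f 1 \<noteq> 0" using f(4)[of 1] by auto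
  then have f1: "f 1 = 1" using f(2)[of 1 1] by simp
  from range show ?thesis
  proof
    assume "range f = \<real>"
    then have "\<exists>s. k = of_real s" for k :: 'k
    proof -
      obtain s where "f k = of_real s"
        using \<open>range f = \<real>\<close> by (metis Reals_cases rangeI)
      then have "f k = f (s *\<^sub>R 1)" by (simp only: f(3) f1) (simp add: scaleR_conv_of_real)
      then show ?thesis using inj by (metis of_real_def)
    qed
    then show ?thesis by (metis add.right_neutral mult_zero_left of_real_0)
  next
    assume "range f = UNIV"
    then obtain j where j: "f j = \<i>" by (metis surjD)
    have "k = of_real (Re (f k)) + of_real (Im (f k)) * j" for k :: 'k
    proof (rule inj)
      show "f k = f (of_real (Re (f k)) + of_real (Im (f k)) * j)"
        by (simp add: f(1) f(2) j of_real_def f(3) f1) (simp add: complex_eq_iff)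
    qed
    then show ?thesis by blast
  qed
qed

context banach_space_over
begin

lemma scaleR_eq_scale: "r *\<^sub>R x = scale (of_real r) x"
  by (simp add: scale_of_real)

lemma bounded_linear_scale: "bounded_linear (scale k)"
proof (rule bounded_linear_intro[where K = "norm k"])
  show "scale k (r *\<^sub>R x) = r *\<^sub>R scale k x" for r x
    by (simp add: scaleR_eq_scale mult.commute)
qed (auto simp: scale_right_distrib norm_scale mult.commute)

lemma linear_on_imp_linear: "linear_on UNIV T \<Longrightarrow> linear T"
  by (intro linearI) (auto simp: linear_on_def scaleR_eq_scale)

lemma subspace_closure:
  assumes "subspace Y" shows "subspace (closure Y)"
  unfolding subspace_def
proof (intro conjI ballI allI)
  show "0 \<in> closure Y"
    using subspace_0[OF assms] closure_subset by blast
next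
  fix x y assume "x \<in> closure Y" "y \<in> closure Y"
  then obtain u v where "\<forall>n. u n \<in> Y" "u \<longlonglongrightarrow> x" "\<forall>n. v n \<in> Y" "v \<longlonglongrightarrow> y"
    by (auto simp: closure_sequential)
  then show "x + y \<in> closure Y"
    unfolding closure_sequential
    by (intro exI[of _ "\<lambda>n. u n + v n"]) (auto intro: tendsto_add subspace_add[OF assms])
next
  fix k x assume "x \<in> closure Y"
  then obtain u where "\<forall>n. u n \<in> Y" "u \<longlonglongrightarrow> x"
    by (auto simp: closure_sequential)
  then show "scale k x \<in> closure Y"
    unfolding closure_sequential
    by (intro exI[of _ "\<lambda>n. scale k (u n)"])
      (auto intro: bounded_linear.tendsto[OF bounded_linear_scale] subspace_scale[OF assms])
qed

text \<open>The functionals are only real-linear: multiplying the vector by a unimodular scalar makes the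
  \<open>k\<close>-th coefficient real and nonnegative.\<close>

lemma biorthogonal_coefficient_bound:
  fixes x :: "nat \<Rightarrow> 'a" and f :: "nat \<Rightarrow> 'a \<Rightarrow> real"
  assumes x: "\<And>n. norm (x n) = 1" and f: "\<And>n. linear (f n)" "\<And>n. f n (x n) = 1"
      "\<And>n y. \<bar>f n y\<bar> \<le> norm y" "\<And>m n k. m < n \<Longrightarrow> f m (scale k (x n)) = 0"
    and "k < n"
  shows "norm (a k) \<le> 2 ^ k * norm (\<Sum>i<n. scale (a i) (x i))"
  using \<open>k < n\<close>
proof (induction k rule: less_induct)
  case (less k)
  let ?y = "\<Sum>i<n. scale (a i) (x i)"
  show ?case
  proof (cases "a k = 0")
    case False
    define u where "u = of_real (norm (a k)) * inverse (a k)"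
    have u: "norm u = 1" "u * a k = of_real (norm (a k))"
      using False by (auto simp: u_def norm_mult norm_inverse)
    have "f k (scale u ?y) = (\<Sum>i<n. f k (scale (u * a i) (x i)))"
      by (simp add: scale_sum_right linear_sum[OF f(1)])
    \<comment> \<open>Terms with index above \<open>k\<close> vanish, since \<open>f k\<close> kills
      all scalar multiples of later vectors. The system is triangular, hence the recursion on
      \<open>k\<close> and the factor \<open>2 ^ k\<close>.\<close>
    also have "\<dots> = (\<Sum>i<Suc k. f k (scale (u * a i) (x i)))"
      using less.prems f(4)[of k] by (intro sum.mono_neutral_right) auto
    also have "\<dots> = (\<Sum>i<k. f k (scale (u * a i) (x i))) + norm (a k)"
      by (simp add: u(2) scale_of_real linear_cmul[OF f(1)] f(2))
    finally have "norm (a k) = f k (scale u ?y) - (\<Sum>i<k. f k (scale (u * a i) (x i)))"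
      by simp
    also have "\<dots> \<le> norm ?y + (\<Sum>i<k. norm (a i))"
    proof -
      have "f k (scale u ?y) \<le> norm ?y"
        using f(3)[of k "scale u ?y"] by (simp add: norm_scale u)
      moreover have "(\<Sum>i<k. - f k (scale (u * a i) (x i))) \<le> (\<Sum>i<k. norm (a i))"
      proof (rule sum_mono)
        fix i
        show "- f k (scale (u * a i) (x i)) \<le> norm (a i)"
          using f(3)[of k "scale (u * a i) (x i)"] by (simp add: norm_scale norm_mult u x)
      qed
      ultimately show ?thesis by (simp add: sum_negf)
    qed
    also have "\<dots> \<le> norm ?y + (\<Sum>i<k. 2 ^ i * norm ?y)"
      using less by (intro add_left_mono sum_mono) auto
    also have "\<dots> = (1 + (\<Sum>i<k. 2 ^ i)) * norm ?y"
      by (simp add: sum_distrib_right distrib_right)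
    also have "\<dots> = 2 ^ k * norm ?y"
      by (simp add: sum_power2[symmetric] geometric_sum[of "2::real"] atLeast0LessThan)
    finally show ?thesis .
  qed simp
qed

text \<open>Coefficients are total functions that vanish outside \<open>I\<close> and from
  \<open>n\<close> on, so that combinations can be padded to a common length and subtracted.\<close>

lemma span_sequence:
  fixes x :: "nat \<Rightarrow> 'a"
  assumes "y \<in> span (x ` I)"
  shows "\<exists>a n. y = (\<Sum>i<n. scale (a i) (x i)) \<and> (\<forall>i. i \<notin> I \<or> n \<le> i \<longrightarrow> a i = 0)"
  using assms
proof (induction rule: span_induct_alt)
  case base
  show ?case by (intro exI[of _ "\<lambda>i. 0"] exI[of _ 0]) simp
next
  case (step c z y)
  then obtain i a n where i: "i \<in> I" "z = x i" and y: "y = (\<Sum>i<n. scale (a i) (x i))"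
      and a: "\<forall>i. i \<notin> I \<or> n \<le> i \<longrightarrow> a i = 0"
    by blast
  define N where "N = max n (Suc i)"
  define b where "b k = a k + (if k = i then c else 0)" for k
  have "y = (\<Sum>k<N. scale (a k) (x k))"
    unfolding y using a by (intro sum.mono_neutral_left) (auto simp: N_def)
  moreover have "scale c z = (\<Sum>k<N. scale (if k = i then c else 0) (x k))"
    unfolding i(2) by (subst sum.mono_neutral_right[of "{..<N}" "{i}"]) (auto simp: N_def)
  ultimately have "scale c z + y = (\<Sum>k<N. scale (b k) (x k))"
    by (simp add: b_def scale_left_distrib sum.distrib add.commute)
  moreover have "\<forall>k. k \<notin> I \<or> N \<le> k \<longrightarrow> b k = 0"
    using a i by (auto simp: b_def N_def)
  ultimately show ?case by blast
qed

text \<open>Unit vectors \<open>x n\<close> with \<open>S (x n)\<close> of size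
  \<open>4 ^ (- n)\<close> are chosen in the kernels of the earlier norming functionals.
  Coefficients grow at most like \<open>2 ^ n\<close>, so \<open>S\<close> is small on the whole
  span and, by continuity, on its closure.\<close>

lemma ex_banach_subspace_almost_null:
  assumes S: "bounded_linear S" "linear_on UNIV S" and "0 < \<eta>"
    and not_below: "\<And>\<Phi>. finite \<Phi> \<Longrightarrow> (\<And>f. f \<in> \<Phi> \<Longrightarrow> bounded_linear f) \<Longrightarrow>
      \<not> bounded_below_on (annihilator \<Phi>) S"
  obtains Y where "banach_subspace Y" "\<And>y. y \<in> Y \<Longrightarrow> norm (S y) \<le> \<eta> * norm y"
proof -
  obtain j :: 'k where j: "\<And>k. \<exists>s t. k = of_real s + of_real t * j"
    using real_or_complex_generator by blast
  \<comment> \<open>The pair \<open>r\<close> is the next vector with its norming functional; only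
    the values of \<open>h\<close> before \<open>n\<close> matter, as dependent choice
    requires.\<close>
  define P where "P h n r \<longleftrightarrow> norm (fst r) = 1 \<and> norm (S (fst r)) \<le> \<eta> / 2 * (1/4) ^ n \<and>
      bounded_linear (snd r) \<and> snd r (fst r) = (1::real) \<and> (\<forall>y. \<bar>snd r y\<bar> \<le> norm y) \<and>
      (\<forall>m<n. \<forall>k. snd (h m) (scale k (fst r)) = 0)"
    for h :: "nat \<Rightarrow> 'a \<times> ('a \<Rightarrow> real)" and n and r :: "'a \<times> ('a \<Rightarrow> real)"
  have "\<exists>h. \<forall>n. P h n (h n)"
  proof (rule dependent_wellorder_choice)
    show "P h n r = P h' n r" if "\<And>m. m < n \<Longrightarrow> h m = h' m" for h h' n r
      using that by (simp add: P_def)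
  next
    fix n h assume *: "\<And>m. m < n \<Longrightarrow> P h m (h m)"
    \<comment> \<open>Including the functionals composed with \<open>scale j\<close> makes the
      earlier functionals vanish on every scalar multiple of the new vector.\<close>
    define \<Phi> where "\<Phi> = (\<lambda>m. snd (h m)) ` {..<n} \<union> (\<lambda>m y. snd (h m) (scale j y)) ` {..<n}"
    have bl: "bounded_linear (snd (h m))" if "m < n" for m
      using *[OF that] by (simp add: P_def)
    have \<Phi>: "finite \<Phi>" "\<And>f. f \<in> \<Phi> \<Longrightarrow> bounded_linear f"
      using bl bounded_linear_compose[OF bl bounded_linear_scale] by (auto simp: \<Phi>_def)
    obtain x0 where x0: "x0 \<in> annihilator \<Phi>" "norm (S x0) < \<eta> / 2 * (1/4) ^ n * norm x0"
    proof -
      have "0 < \<eta> / 2 * (1/4) ^ n" using \<open>0 < \<eta>\<close> by simp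
      then show ?thesis
        using not_below[OF \<Phi>] that unfolding bounded_below_on_def by (meson not_le)
    qed
    define x where "x = inverse (norm x0) *\<^sub>R x0"
    have "x0 \<noteq> 0" using x0(2) linear_0[OF bounded_linear.linear[OF S(1)]] by auto
    then have x: "norm x = 1" "norm (S x) \<le> \<eta> / 2 * (1/4) ^ n"
      using x0(2) by (auto simp: x_def linear_cmul[OF bounded_linear.linear[OF S(1)]] field_simps)
    have ann: "snd (h m) (scale k x) = 0" if "m < n" for m k
    proof -
      interpret bounded_linear "snd (h m)" using bl[OF that] .
      obtain s t where k: "k = of_real s + of_real t * j" using j by blast
      have "snd (h m) x0 = 0" "snd (h m) (scale j x0) = 0"
        using x0(1) that by (auto simp: annihilator_def \<Phi>_def)
      moreover have "scale k x0 = s *\<^sub>R x0 + t *\<^sub>R scale j x0"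
        by (simp add: k scale_left_distrib scaleR_eq_scale)
      moreover have "scale k x = inverse (norm x0) *\<^sub>R scale k x0"
        by (simp add: x_def bounded_linear.linear[OF bounded_linear_scale] linear_cmul)
      ultimately show ?thesis by (simp add: scaleR add)
    qed
    obtain f where "bounded_linear f" "f x = norm x" "\<And>y. \<bar>f y\<bar> \<le> norm y"
      using norming_functional[of x] by blast
    then have "P h n (x, f)"
      using x ann by (simp add: P_def)
    then show "\<exists>r. P h n r" ..
  qed
  then obtain h where h: "\<And>n. P h n (h n)" by blast
  define x f where "x n = fst (h n)" and "f n = snd (h n)" for n
  have x: "\<And>n. norm (x n) = 1" and Sx: "\<And>n. norm (S (x n)) \<le> \<eta> / 2 * (1/4) ^ n"
    and f: "\<And>n. linear (f n)" "\<And>n. f n (x n) = 1" "\<And>n y. \<bar>f n y\<bar> \<le> norm y"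
      "\<And>m n k. m < n \<Longrightarrow> f m (scale k (x n)) = 0"
    using h by (auto simp: P_def x_def f_def bounded_linear.linear)
  have coeff: "norm (a k) \<le> 2 ^ k * norm (\<Sum>i<n. scale (a i) (x i))" if "k < n" for a k n
    by (rule biorthogonal_coefficient_bound[where x = x and f = f, OF x f that])
  have "inj x"
  proof (rule linorder_inj_onI)
    fix m n :: nat assume "m < n"
    then show "x m \<noteq> x n"
      using f(2)[of m] f(4)[of m n 1] by auto
  qed auto
  have indep: "independent (range x)"
  proof
    assume "dependent (range x)"
    then obtain m where "x m \<in> span (range x - {x m})"
      by (auto simp: dependent_def)
    moreover have "range x - {x m} = x ` (UNIV - {m})"
      using \<open>inj x\<close> by (auto simp: inj_eq)
    ultimately obtain a n where a: "x m = (\<Sum>i<n. scale (a i) (x i))" "a m = 0"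
        "\<And>i. n \<le> i \<Longrightarrow> a i = 0"
      using span_sequence[of "x m" x "UNIV - {m}"] by auto
    define N where "N = max n (Suc m)"
    \<comment> \<open>Subtracting the two expansions of \<open>x m\<close> gives a vanishing
      combination with \<open>b m = - 1\<close>, against the coefficient bound.\<close>
    define b where "b k = a k - (if k = m then 1 else 0)" for k
    have "x m = (\<Sum>k<N. scale (a k) (x k))"
      unfolding a(1) using a(3) by (intro sum.mono_neutral_left) (auto simp: N_def)
    moreover have "x m = (\<Sum>k<N. scale (if k = m then 1 else 0) (x k))"
      by (subst sum.mono_neutral_right[of "{..<N}" "{m}"]) (auto simp: N_def)
    ultimately have "(\<Sum>k<N. scale (b k) (x k)) = 0"
      by (simp add: b_def scale_left_diff_distrib sum_subtractf)
    then show False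
      using coeff[of m N b] a(2) by (simp add: b_def less_max_iff_disj N_def)
  qed
  have small: "norm (S y) \<le> \<eta> * norm y" if y_span: "y \<in> span (range x)" for y
  proof -
    obtain a n where y: "y = (\<Sum>i<n. scale (a i) (x i))"
      using span_sequence[OF y_span] by blast
    have half: "(1/2) ^ i = 2 ^ i * (1/4 :: real) ^ i" for i
      by (simp flip: power_mult_distrib)
    have "norm (S y) \<le> (\<Sum>i<n. norm (scale (a i) (S (x i))))"
      using S(2) by (simp add: y linear_sum[OF linear_on_imp_linear[OF S(2)]] linear_on_def norm_sum)
    \<comment> \<open>The factor \<open>2 ^ i\<close> from the coefficients against
      \<open>(1/4) ^ i\<close> leaves a geometric series of sum at most \<open>2\<close>, which
      cancels the \<open>2\<close> in \<open>\<eta> / 2\<close>.\<close>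
    also have "\<dots> \<le> (\<Sum>i<n. (2 ^ i * norm y) * (\<eta> / 2 * (1/4) ^ i))"
      unfolding norm_scale y using coeff[of _ n a] Sx by (intro sum_mono mult_mono) auto
    also have "\<dots> = \<eta> / 2 * norm y * (\<Sum>i<n. (1/2) ^ i)"
      unfolding sum_distrib_left by (intro sum.cong refl) (simp only: half ac_simps)
    also have "\<dots> \<le> \<eta> / 2 * norm y * 2"
      using \<open>0 < \<eta>\<close> by (intro mult_left_mono) (auto simp: geometric_sum)
    finally show ?thesis by simp
  qed
  define Y where "Y = closure (span (range x))"
  have "Y \<subseteq> {y. norm (S y) \<le> \<eta> * norm y}"
    unfolding Y_def
  proof (rule closure_minimal)
    show "closed {y. norm (S y) \<le> \<eta> * norm y}"
      by (intro closed_Collect_le continuous_intros linear_continuous_on[OF S(1)])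
  qed (use small in auto)
  moreover have "banach_subspace Y"
    unfolding banach_subspace_def
  proof (intro conjI)
    show "subspace Y" unfolding Y_def by (intro subspace_closure subspace_span)
    show "infinite_dimensional Y"
      unfolding infinite_dimensional_def
    proof
      assume "\<exists>B. finite B \<and> span B = Y"
      then obtain B where B: "finite B" "span B = Y" by blast
      have "range x \<subseteq> span B"
        unfolding B(2) Y_def using span_superset closure_subset by blast
      then have "finite (range x)"
        using independent_span_bound[OF B(1) indep] by blast
      then show False
        using finite_imageD[OF _ \<open>inj x\<close>] by simp
    qed
  qed (simp add: Y_def)
  ultimately show ?thesis using that by blast
qed

lemma ex_approximate_eigenspace:
  assumes T: "bounded_linear T" "linear_on UNIV T" "bounded_below_on UNIV T" "\<not> surj T"
    and "0 < \<eta>"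
  obtains t Y where "0 \<le> t" "banach_subspace Y" "\<And>y. y \<in> Y \<Longrightarrow> norm (T y - t *\<^sub>R y) \<le> \<eta> * norm y"
proof -
  note thesisI = that
  let ?S = "\<lambda>t x. T x - t *\<^sub>R x"
  obtain t where t: "0 \<le> t" "\<And>\<Phi>. finite \<Phi> \<Longrightarrow> (\<And>f. f \<in> \<Phi> \<Longrightarrow> bounded_linear f) \<Longrightarrow>
      \<not> bounded_below_on (annihilator \<Phi>) (?S t)"
    using ex_not_bounded_below_shift[OF T(1,3,4)] by auto
  have S: "bounded_linear (?S t)"
    by (intro bounded_linear_sub T(1) bounded_linear_scaleR_right)
  have linS: "linear_on UNIV (?S t)"
    using T(2) by (simp add: linear_on_def scaleR_eq_scale scale_right_distrib scale_right_diff_distrib mult.commute)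
  show ?thesis
  proof (rule ex_banach_subspace_almost_null[OF S linS \<open>0 < \<eta>\<close>])
    show "\<not> bounded_below_on (annihilator \<Phi>) (?S t)"
      if "finite \<Phi>" "\<And>f. f \<in> \<Phi> \<Longrightarrow> bounded_linear f" for \<Phi>
      using t(2) that .
    show ?thesis if "banach_subspace Y" "\<And>y. y \<in> Y \<Longrightarrow> norm (?S t y) \<le> \<eta> * norm y" for Y
      using thesisI t(1) that .
  qed
qed

section \<open>The HI inequality on two approximate eigenspaces\<close>

lemma banach_subspace_nonzero:
  assumes "banach_subspace Y"
  obtains y where "y \<in> Y" "y \<noteq> 0"
proof -
  have "span {} \<noteq> Y"
    using assms by (auto simp: banach_subspace_def infinite_dimensional_def)
  then show ?thesis
    using assms that subspace_0[of Y] by (auto simp: banach_subspace_def)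
qed

lemma HI_approximate_eigenspaces:
  assumes "HI D" "1 \<le> D" and T: "linear T" "\<And>x. a * norm x \<le> norm (T x)" "\<And>x. norm (T x) \<le> b * norm x"
    and Y: "banach_subspace Y" "\<And>y. y \<in> Y \<Longrightarrow> norm (T y - s *\<^sub>R y) \<le> \<eta> * norm y"
    and Z: "banach_subspace Z" "\<And>z. z \<in> Z \<Longrightarrow> norm (T z + t *\<^sub>R z) \<le> \<eta> * norm z"
    and "0 \<le> s" "0 \<le> t" "0 < \<eta>" "2 * \<eta> < a"
  shows "D * (a - 2 * \<eta>) < b + \<eta>"
proof -
  \<comment> \<open>A nonzero vector of \<open>Y\<close> is stretched by at least \<open>a\<close>
    and by at most \<open>s + \<eta>\<close>.\<close>
  have s: "a - \<eta> \<le> s"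
  proof -
    obtain y where y: "y \<in> Y" "y \<noteq> 0" using banach_subspace_nonzero[OF Y(1)] .
    have "a * norm y \<le> (s + \<eta>) * norm y"
      using T(2)[of y] Y(2)[OF y(1)] norm_triangle_ineq[of "T y - s *\<^sub>R y" "s *\<^sub>R y"] \<open>0 \<le> s\<close>
      by (simp add: algebra_simps)
    then show ?thesis using y(2) by simp
  qed
  have t: "a - \<eta> \<le> t"
  proof -
    obtain z where z: "z \<in> Z" "z \<noteq> 0" using banach_subspace_nonzero[OF Z(1)] .
    have "a * norm z \<le> (t + \<eta>) * norm z"
      using T(2)[of z] Z(2)[OF z(1)] norm_triangle_ineq4[of "T z + t *\<^sub>R z" "t *\<^sub>R z"] \<open>0 \<le> t\<close>
      by (simp add: algebra_simps)
    then show ?thesis using z(2) by simp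
  qed
  obtain y z where yz: "y \<in> Y" "z \<in> Z" "norm (y + z) > D * norm (y - z)"
    using \<open>HI D\<close> Y(1) Z(1) unfolding HI_def by blast
  define U V where "U = norm (y + z)" and "V = norm (y - z)"
  have UV: "D * V < U" "0 \<le> V" using yz(3) by (auto simp: U_def V_def)
  have "2 * norm y = norm ((y + z) + (y - z))" "2 * norm z = norm ((y + z) - (y - z))"
    by (simp_all flip: scaleR_2)
  then have nyz: "norm y + norm z \<le> U + V"
    using norm_triangle_ineq[of "y + z" "y - z"] norm_triangle_ineq4[of "y + z" "y - z"]
    by (simp add: U_def V_def)
  let ?w = "s *\<^sub>R y + t *\<^sub>R z"
  have weq: "?w = T (y - z) - (T y - s *\<^sub>R y) + (T z + t *\<^sub>R z)"
    by (simp add: linear_diff[OF T(1)])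
  have "norm ?w \<le> norm (T (y - z) - (T y - s *\<^sub>R y)) + norm (T z + t *\<^sub>R z)"
    unfolding weq by (rule norm_triangle_ineq)
  then have "norm ?w \<le> norm (T (y - z)) + norm (T y - s *\<^sub>R y) + norm (T z + t *\<^sub>R z)"
    using norm_triangle_ineq4[of "T (y - z)" "T y - s *\<^sub>R y"] by linarith
  also have "\<dots> \<le> b * V + \<eta> * (norm y + norm z)"
    using T(3)[of "y - z"] Y(2)[OF yz(1)] Z(2)[OF yz(2)] by (simp add: V_def distrib_left)
  also have "\<dots> \<le> b * V + \<eta> * (U + V)"
    using nyz \<open>0 < \<eta>\<close> by simp
  finally have w: "norm ?w \<le> b * V + \<eta> * (U + V)" .
  \<comment> \<open>Isolating \<open>y + z\<close> turns the upper bound on \<open>?w\<close> into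
    one for \<open>U\<close> in terms of \<open>V\<close>, to be compared with
    \<open>D * V < U\<close>.\<close>
  have "(s + t) *\<^sub>R (y + z) = 2 *\<^sub>R ?w - (s - t) *\<^sub>R (y - z)"
    by (subst scaleR_2) (simp add: algebra_simps)
  then have "norm ((s + t) *\<^sub>R (y + z)) \<le> 2 * norm ?w + \<bar>s - t\<bar> * V"
    using norm_triangle_ineq4[of "2 *\<^sub>R ?w" "(s - t) *\<^sub>R (y - z)"] by (simp add: V_def)
  then have "(s + t) * U \<le> 2 * norm ?w + \<bar>s - t\<bar> * V"
    using \<open>0 \<le> s\<close> \<open>0 \<le> t\<close> by (simp add: U_def)
  then have le: "(s + t - 2 * \<eta>) * U \<le> (2 * b + \<bar>s - t\<bar> + 2 * \<eta>) * V"
    using w by (simp add: algebra_simps)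
  have pos: "0 < s + t - 2 * \<eta>" using s t \<open>2 * \<eta> < a\<close> by simp
  have "(s + t - 2 * \<eta>) * (D * V) < (s + t - 2 * \<eta>) * U"
    using UV(1) pos by simp
  then have "((s + t - 2 * \<eta>) * D) * V < (2 * b + \<bar>s - t\<bar> + 2 * \<eta>) * V"
    using le by (simp add: mult.assoc)
  then have "(s + t - 2 * \<eta>) * D < 2 * b + \<bar>s - t\<bar> + 2 * \<eta>"
    using UV(2) mult_right_less_imp_less by blast
  \<comment> \<open>\<open>1 \<le> D\<close> lets \<open>\<bar>s - t\<bar>\<close> move to the
    left-hand side, where \<open>s + t - \<bar>s - t\<bar>\<close> is twice the minimum of
    \<open>s\<close> and \<open>t\<close>, at least \<open>2 * a - 2 * \<eta>\<close>.\<close>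
  moreover have "\<bar>s - t\<bar> \<le> D * \<bar>s - t\<bar>"
    using \<open>1 \<le> D\<close> mult_right_mono[of 1 D "\<bar>s - t\<bar>"] by simp
  moreover have "D * (2 * a - 4 * \<eta>) \<le> D * (s + t - 2 * \<eta> - \<bar>s - t\<bar>)"
    using s t \<open>1 \<le> D\<close> by (intro mult_left_mono) auto
  ultimately show ?thesis by (simp add: algebra_simps)
qed

section \<open>Operator norms on subspaces and the contradiction\<close>

lemma linear_on_zero:
  assumes "linear_on Y T" "subspace Y" shows "T 0 = 0"
  using assms subspace_0[of Y] unfolding linear_on_def by (metis scale_zero_left)

lemma continuous_linear_on_bounded:
  assumes T: "linear_on Y T" "subspace Y" "continuous_on Y T"
  obtains K where "0 < K" "\<And>y. y \<in> Y \<Longrightarrow> norm (T y) \<le> K * norm y"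
proof -
  note T0 = linear_on_zero[OF T(1,2)]
  obtain d where d: "0 < d" "\<And>y. y \<in> Y \<Longrightarrow> norm y < d \<Longrightarrow> norm (T y) < 1"
    using T(3) subspace_0[OF T(2)] unfolding continuous_on_iff
    by (metis T0 dist_0_norm dist_commute zero_less_one)
  have "norm (T y) \<le> 2 / d * norm y" if "y \<in> Y" for y
  proof (cases "y = 0")
    case False
    define r where "r = d / 2 / norm y"
    have r: "0 < r" "r * norm y < d" using False d(1) by (auto simp: r_def)
    have "T (r *\<^sub>R y) = r *\<^sub>R T y" "r *\<^sub>R y \<in> Y"
      using T(1,2) that by (auto simp: linear_on_def scaleR_eq_scale subspace_scale)
    then have "r * norm (T y) < 1"
      using d(2)[of "r *\<^sub>R y"] r by simp
    then show ?thesis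
      using False d(1) by (simp add: r_def field_simps)
  qed (simp add: T0)
  then show ?thesis using that[of "2 / d"] d(1) by simp
qed

text \<open>Continuity bounds the set of quotients above, so the real supremum is a true upper
  bound; at \<open>0\<close> the quotient is \<open>0\<close> by convention.\<close>

lemma norm_le_onorm_on:
  assumes T: "linear_on Y T" "subspace Y" "continuous_on Y T" and "y \<in> Y"
  shows "norm (T y) \<le> onorm_on Y T * norm y"
proof (cases "y = 0")
  case False
  obtain K where K: "0 < K" "\<And>y. y \<in> Y \<Longrightarrow> norm (T y) \<le> K * norm y"
    using continuous_linear_on_bounded[OF T] by blast
  have "norm (T y) / norm y \<le> onorm_on Y T"
    unfolding onorm_on_def
  proof (rule cSUP_upper[OF \<open>y \<in> Y\<close>], rule bdd_aboveI2)
    fix x assume "x \<in> Y"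
    then show "norm (T x) / norm x \<le> K"
      using K by (cases "x = 0") (auto simp: field_simps)
  qed
  then show ?thesis using False by (simp add: field_simps)
qed (simp add: linear_on_zero[OF T(1,2)])

text \<open>\<open>isomorphic_with_constant\<close> states linearity for \<open>T\<close> only; that
  of \<open>T'\<close> is derived here so that its \<open>onorm_on\<close> can be used.\<close>

lemma linear_on_inverse:
  assumes "linear_on X T" "subspace X" "\<And>x. x \<in> X \<Longrightarrow> T' (T x) = x"
  shows "linear_on (T ` X) T'"
  unfolding linear_on_def
proof (intro conjI ballI allI)
  fix u v assume "u \<in> T ` X" "v \<in> T ` X"
  then obtain x y where *: "x \<in> X" "u = T x" "y \<in> X" "v = T y" by blast
  then have "u + v = T (x + y)" using assms(1) by (simp add: linear_on_def)
  then show "T' (u + v) = T' u + T' v" using * assms(3) subspace_add[OF assms(2)] by simp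
next
  fix c u assume "u \<in> T ` X"
  then obtain x where *: "x \<in> X" "u = T x" by blast
  then have "scale c u = T (scale c x)" using assms(1) by (simp add: linear_on_def)
  then show "T' (scale c u) = scale c (T' u)" using * assms(3) subspace_scale[OF assms(2)] by simp
qed

theorem HI_not_isomorphic_proper_subspace:
  assumes "1 \<le> C" "0 < \<epsilon>" "HI (C + \<epsilon>)" and Y: "banach_subspace Y" "Y \<noteq> UNIV"
  shows "\<not> isomorphic_with_constant C UNIV Y"
proof
  assume "isomorphic_with_constant C UNIV Y"
  then obtain T T' where lin: "linear_on UNIV T" and hom: "homeomorphism UNIV Y T T'"
      and C: "onorm_on UNIV T * onorm_on Y T' \<le> C"
    unfolding isomorphic_with_constant_def by blast
  have T: "continuous_on UNIV T" "continuous_on Y T'" "range T = Y" "\<And>x. T' (T x) = x"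
    using hom by (auto simp: homeomorphism_def)
  have lin': "linear_on Y T'"
    using linear_on_inverse[OF lin subspace_UNIV T(4)] T(3) by simp
  define b b' where "b = onorm_on UNIV T" and "b' = onorm_on Y T'"
  have up: "norm (T x) \<le> b * norm x" for x
    using norm_le_onorm_on[OF lin subspace_UNIV T(1)] by (simp add: b_def)
  have low: "norm x \<le> b' * norm (T x)" for x
    using norm_le_onorm_on[OF lin' _ T(2), of "T x"] T(3,4) Y(1)
    by (auto simp: b'_def banach_subspace_def)
  obtain x0 where "x0 \<in> Y" "x0 \<noteq> 0" using banach_subspace_nonzero[OF Y(1)] .
  then have b': "0 < b'"
    using low[of x0] by (metis mult_nonpos_nonneg norm_ge_zero not_less order_trans zero_less_norm_iff)
  define a where "a = 1 / b'"
  have a: "0 < a" "\<And>x. a * norm x \<le> norm (T x)" "b \<le> C * a"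
    using b' low C by (auto simp: a_def field_simps b_def b'_def)
  have blT: "bounded_linear T"
    using up linear_on_imp_linear[OF lin]
    by (intro bounded_linear_intro[of T b]) (auto simp: linear_add linear_cmul mult.commute)
  \<comment> \<open>Chosen so that
    \<open>(C + \<epsilon>) * (a - 2 * \<eta>) = C * a + \<eta>\<close>, which contradicts the
    strict HI estimate because \<open>b \<le> C * a\<close>.\<close>
  define \<eta> where "\<eta> = \<epsilon> * a / (1 + 2 * (C + \<epsilon>))"
  have pos: "0 < 1 + 2 * (C + \<epsilon>)" using assms by simp
  have \<eta>: "0 < \<eta>" "\<eta> * (1 + 2 * (C + \<epsilon>)) = \<epsilon> * a"
    using assms(2) a(1) pos by (simp_all add: \<eta>_def)
  have "\<epsilon> * (2 * \<eta>) < \<eta> * (1 + 2 * (C + \<epsilon>))"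
    using \<eta>(1) assms(1) by (simp add: algebra_simps add_pos_pos)
  then have "2 * \<eta> < a"
    using \<eta>(2) assms(2) by simp
  have below: "bounded_below_on UNIV T" "bounded_below_on UNIV (\<lambda>x. - T x)"
    using a by (auto simp: bounded_below_on_def)
  have nsurj: "\<not> surj T"
    using T(3) Y(2) by simp
  have nsurj': "\<not> surj (\<lambda>x. - T x)"
  proof
    assume "surj (\<lambda>x. - T x)"
    then have "\<exists>x. - y = - T x" for y by (rule surjD)
    then have "surj T" by (auto simp: surj_def)
    then show False using nsurj by blast
  qed
  \<comment> \<open>\<open>- T\<close> satisfies the same hypotheses; its approximate eigenvalue
    \<open>t\<close> is the approximate eigenvalue \<open>- t\<close> of \<open>T\<close>.\<close>
  have linm: "linear_on UNIV (\<lambda>x. - T x)"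
    using lin by (simp add: linear_on_def)
  obtain s V where s: "0 \<le> s" "banach_subspace V" "\<And>y. y \<in> V \<Longrightarrow> norm (T y - s *\<^sub>R y) \<le> \<eta> * norm y"
    using ex_approximate_eigenspace[OF blT lin below(1) nsurj \<eta>(1)] by blast
  obtain t W where t: "0 \<le> t" "banach_subspace W" "\<And>y. y \<in> W \<Longrightarrow> norm (- T y - t *\<^sub>R y) \<le> \<eta> * norm y"
    using ex_approximate_eigenspace[OF bounded_linear_minus[OF blT] linm below(2) nsurj' \<eta>(1)] by blast
  have t': "norm (T y + t *\<^sub>R y) \<le> \<eta> * norm y" if "y \<in> W" for y
    using t(3)[OF that] norm_minus_cancel[of "T y + t *\<^sub>R y"] by simp
  have "(C + \<epsilon>) * (a - 2 * \<eta>) < b + \<eta>"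
    using assms(1,2)
    by (intro HI_approximate_eigenspaces[OF assms(3) _ bounded_linear.linear[OF blT] a(2) up s(2,3) t(2) t'
          s(1) t(1) \<eta>(1) \<open>2 * \<eta> < a\<close>]) auto
  then have "\<epsilon> * a < \<eta> * (1 + 2 * (C + \<epsilon>))"
    using a(3) by (simp add: algebra_simps)
  then show False using \<eta>(2) by simp
qed

end

theorem theorem4p4:
  fixes scale :: "'k::real_or_complex \<Rightarrow> 'a::banach \<Rightarrow> 'a"
    and C :: real
  assumes "banach_space_over scale"
    and "banach_space_over.infinite_dimensional scale (UNIV :: 'a set)"
    and "C \<ge> 1"
    and "\<exists>\<epsilon>>0. banach_space_over.HI scale (C + \<epsilon>)"
  shows "\<nexists>Y. banach_space_over.banach_subspace scale Y \<and> Y \<noteq> UNIV \<and>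
           banach_space_over.isomorphic_with_constant scale C UNIV Y"
  using banach_space_over.HI_not_isomorphic_proper_subspace[OF assms(1,3)] assms(4) by blast

end
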